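(* For $i=1,2$, let $X_i$ be a Cantor set and let $\Gamma_i\subset\mathrm{Homeo}(X_i)$ be a subgroup of class F. Suppose that $\Phi:\Gamma_1\to\Gamma_2$ is a group isomorphism. Then there exists a homeomorphism $\varphi:X_1\to X_2$ such that $\Phi(\alpha)=\varphi\circ\alpha\circ\varphi^{-1}$ for all $\alpha\in\Gamma_1$.
   Context: A Cantor set is a (non-empty) compact, metrizable, totally disconnected space with no isolated points. $\mathrm{Homeo}(X)$ is the group of homeomorphisms of $X$. For $\alpha\in\mathrm{Homeo}(X)$, $\mathrm{supp}(\alpha)$ is the closure of $\{x\in X\mid\alpha(x)\neq x\}$. Clopen means closed and open. A subgroup $\Gamma\subset\mathrm{Homeo}(X)$, $X$ a Cantor set, is of class F if: (F0) for any $\alpha\in\Gamma$ with $\alpha^2=1$, $\mathrm{supp}(\alpha)$ is clopen; (F1) for any $x\in X$ and any clopen neighborhood $A\subset X$ of $x$, there exists $\alpha\in\Gamma\setminus\{1\}$ such that $x\in\mathrm{supp}(\alpha)$, $\mathrm{supp}(\alpha)\subset A$ and $\alpha^2=1$; (F2) for any $\alpha\in\Gamma\setminus\{1\}$ with $\alpha^2=1$ and any non-empty clopen set $A\subset\mathrm{supp}(\alpha)$, there exists $\beta\in\Gamma\setminus\{1\}$ such that $\mathrm{supp}(\beta)\subset A\cup\alpha(A)$ and $\beta(x)=\alpha(x)$ for every $x\in\mathrm{supp}(\beta)$; (F3) for any non-empty clopen set $A\subset X$, there exists $\alpha\in\Gamma$ such that $\mathrm{supp}(\alpha)\subset A$ and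 $\alpha^2\neq1$. *)

theory Defs
  imports "HOL-Analysis.Analysis" "HOL-Algebra.Bij"
begin

definition totally_disconnected_space :: "'a topology \<Rightarrow> bool" where
  "totally_disconnected_space X \<longleftrightarrow> (\<forall>C. connectedin X C \<longrightarrow> (\<exists>a. C \<subseteq> {a}))"

definition cantor_space :: "'a topology \<Rightarrow> bool" where
  "cantor_space X \<longleftrightarrow>
     topspace X \<noteq> {} \<and> compact_space X \<and> metrizable_space X \<and>
     totally_disconnected_space X \<and> (\<forall>x\<in>topspace X. \<not> openin X {x})"

definition clopenin :: "'a topology \<Rightarrow> 'a set \<Rightarrow> bool" where
  "clopenin X A \<longleftrightarrow> closedin X A \<and> openin X A"

text \<open>As in \<^const>\<open>BijGroup\<close>, group elements are extensional functions on the underlying set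
  of the space, so that equality of elements is pointwise equality there, and the unit is the
  restricted identity.\<close>

definition Homeo :: "'a topology \<Rightarrow> ('a \<Rightarrow> 'a) monoid" where
  "Homeo X = (BijGroup (topspace X))
     \<lparr>carrier := {f \<in> Bij (topspace X). homeomorphic_map X X f}\<rparr>"

lemma one_Homeo: "\<one>\<^bsub>Homeo X\<^esub> = (\<lambda>x\<in>topspace X. x)"
  by (simp add: Homeo_def BijGroup_def)

lemma mult_Homeo:
  assumes "f \<in> carrier (Homeo X)" "g \<in> carrier (Homeo X)"
  shows "f \<otimes>\<^bsub>Homeo X\<^esub> g = compose (topspace X) f g"
  using assms by (simp add: Homeo_def BijGroup_def)

lemma group_Homeo: "group (Homeo X)"
proof -
  let ?S = "topspace X"
  interpret B: group "BijGroup ?S" by (rule group_BijGroup)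
  have inv: "inv\<^bsub>BijGroup ?S\<^esub> f = (\<lambda>x\<in>?S. inv_into ?S f x)" if "f \<in> Bij ?S" for f
    using that by (rule inv_BijGroup)
  have "subgroup {f \<in> Bij ?S. homeomorphic_map X X f} (BijGroup ?S)"
  proof (rule B.subgroupI)
    show "{f \<in> Bij ?S. homeomorphic_map X X f} \<subseteq> carrier (BijGroup ?S)"
      by (auto simp: BijGroup_def)
    have "homeomorphic_map X X (\<lambda>x\<in>?S. x)"
      by (rule homeomorphic_map_eq [of _ _ id]) auto
    then show "{f \<in> Bij ?S. homeomorphic_map X X f} \<noteq> {}"
      using id_Bij by blast
  next
    fix f assume "f \<in> {f \<in> Bij ?S. homeomorphic_map X X f}"
    then have f: "f \<in> Bij ?S" "homeomorphic_map X X f" by blast+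
    then obtain g where g: "homeomorphic_maps X X f g"
      unfolding homeomorphic_map_maps by blast
    then have g': "\<And>x. x \<in> ?S \<Longrightarrow> g x \<in> ?S \<and> f (g x) = x" "homeomorphic_map X X g"
      by (auto simp: homeomorphic_maps_def continuous_map_def Pi_iff)
        (metis g homeomorphic_map_maps homeomorphic_maps_sym)
    have inj: "inj_on f ?S" using f(2) by (simp add: homeomorphic_map_def)
    have "g x = (\<lambda>x\<in>?S. inv_into ?S f x) x" if "x \<in> ?S" for x
      using inv_into_f_eq[OF inj, of "g x" x] g'(1)[OF that] that by simp
    with g'(2) have "homeomorphic_map X X (\<lambda>x\<in>?S. inv_into ?S f x)"
      by (rule homeomorphic_map_eq)
    then show "inv\<^bsub>BijGroup ?S\<^esub> f \<in> {f \<in> Bij ?S. homeomorphic_map X X f}"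
      using f(1) by (simp add: inv restrict_inv_into_Bij)
  next
    fix f g
    assume "f \<in> {f \<in> Bij ?S. homeomorphic_map X X f}" "g \<in> {f \<in> Bij ?S. homeomorphic_map X X f}"
    then have fg: "f \<in> Bij ?S" "g \<in> Bij ?S" "homeomorphic_map X X f" "homeomorphic_map X X g"
      by blast+
    have "homeomorphic_map X X (f \<circ> g)"
      using fg by (blast intro: homeomorphic_map_compose)
    then have "homeomorphic_map X X (compose ?S f g)"
      by (rule homeomorphic_map_eq) (simp add: compose_def)
    then show "f \<otimes>\<^bsub>BijGroup ?S\<^esub> g \<in> {f \<in> Bij ?S. homeomorphic_map X X f}"
      using fg by (simp add: BijGroup_def compose_Bij)
  qed
  then show ?thesis
    unfolding Homeo_def by (rule B.subgroup_imp_group)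
qed

definition supp :: "'a topology \<Rightarrow> ('a \<Rightarrow> 'a) \<Rightarrow> 'a set" where
  "supp X \<alpha> = Abstract_Topology.closure_of X {x \<in> topspace X. \<alpha> x \<noteq> x}"

locale class_F = subgroup \<Gamma> "Homeo X" for X :: "'a topology" and \<Gamma> :: "('a \<Rightarrow> 'a) set" +
  assumes F0: "\<And>\<alpha>. \<alpha> \<in> \<Gamma> \<Longrightarrow> \<alpha> \<otimes>\<^bsub>Homeo X\<^esub> \<alpha> = \<one>\<^bsub>Homeo X\<^esub> \<Longrightarrow> clopenin X (supp X \<alpha>)"
    and F1: "\<And>x A. x \<in> A \<Longrightarrow> clopenin X A \<Longrightarrow>
      \<exists>\<alpha> \<in> \<Gamma> - {\<one>\<^bsub>Homeo X\<^esub>}. x \<in> supp X \<alpha> \<and> supp X \<alpha> \<subseteq> A \<and> \<alpha> \<otimes>\<^bsub>Homeo X\<^esub> \<alpha> = \<one>\<^bsub>Homeo X\<^esub>"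
    and F2: "\<And>\<alpha> A. \<alpha> \<in> \<Gamma> - {\<one>\<^bsub>Homeo X\<^esub>} \<Longrightarrow> \<alpha> \<otimes>\<^bsub>Homeo X\<^esub> \<alpha> = \<one>\<^bsub>Homeo X\<^esub> \<Longrightarrow>
      A \<noteq> {} \<Longrightarrow> clopenin X A \<Longrightarrow> A \<subseteq> supp X \<alpha> \<Longrightarrow>
      \<exists>\<beta> \<in> \<Gamma> - {\<one>\<^bsub>Homeo X\<^esub>}. supp X \<beta> \<subseteq> A \<union> \<alpha> ` A \<and> (\<forall>x\<in>supp X \<beta>. \<beta> x = \<alpha> x)"
    and F3: "\<And>A. A \<noteq> {} \<Longrightarrow> clopenin X A \<Longrightarrow>
      \<exists>\<alpha> \<in> \<Gamma>. supp X \<alpha> \<subseteq> A \<and> \<alpha> \<otimes>\<^bsub>Homeo X\<^esub> \<alpha> \<noteq> \<one>\<^bsub>Homeo X\<^esub>"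

end

theory Submission
  imports Defs
begin

text \<open>For an involution \<open>\<tau>\<close>, the elements supported in \<open>supp \<tau>\<close> can be described by commutation
  alone. Let \<open>U\<close> be the set of involutions that commute with \<open>\<tau>\<close> and with all their own conjugates
  under the centralizer of \<open>\<tau>\<close>: by F3 they are supported in \<open>supp \<tau>\<close>, and by F2 they include
  restrictions of \<open>\<tau>\<close> to arbitrarily small \<open>\<tau>\<close>-invariant sets. Hence an element commuting with \<open>U\<close>
  preserves the \<open>\<tau>\<close>-orbits in \<open>supp \<tau>\<close>, so its square is trivial there, and conversely every element
  supported off \<open>supp \<tau>\<close> commutes with \<open>U\<close>. The centralizer of all these squares is exactly the set of
  elements supported in \<open>supp \<tau>\<close>. So an abstract isomorphism preserves inclusion between supports of
  involutions. By F0 and F1 these supports form a base of clopen sets, and an order isomorphism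
  between clopen bases of compact Hausdorff spaces comes from a homeomorphism.\<close>

section \<open>Clopen neighbourhoods in a Cantor set\<close>

text \<open>In a compact Hausdorff space a connected component can be separated by a clopen
  partition from any closed set disjoint from it. Total disconnectedness makes the component of
  \<open>x\<close> a singleton, and the complement of \<open>U\<close> serves as the closed
  set.\<close>

lemma cantor_clopen_base:
  assumes "cantor_space X" "openin X U" "x \<in> U"
  obtains A where "clopenin X A" "x \<in> A" "A \<subseteq> U"
proof -
  have X: "compact_space X" "Hausdorff_space X" "locally_compact_space X"
    and td: "totally_disconnected_space X"
    using assms(1) metrizable_imp_Hausdorff_space compact_imp_locally_compact_space
    by (auto simp: cantor_space_def)
  have x: "x \<in> topspace X"
    using assms openin_subset by blast
  obtain a where "connected_component_of_set X x \<subseteq> {a}"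
    using td connectedin_connected_component_of unfolding totally_disconnected_space_def by metis
  moreover have "x \<in> connected_component_of_set X x"
    using x by (simp add: connected_component_of_refl)
  ultimately have comp: "connected_component_of_set X x = {x}"
    by blast
  then have "{x} \<in> connected_components_of X"
    using x connected_component_in_connected_components_of by metis
  moreover have "closedin X (topspace X - U)" "disjnt {x} (topspace X - U)" "compactin X {x}"
    using assms x by auto
  ultimately have "separated_between X {x} (topspace X - U)"
    using X separated_between_compact_connected_component by blast
  then obtain A B where AB: "openin X A" "openin X B" "A \<union> B = topspace X" "disjnt A B"
      "x \<in> A" "topspace X - U \<subseteq> B"
    unfolding separated_between_def by auto
  then have "A = topspace X - B"
    by (auto simp: disjnt_iff)
  then have "closedin X A"
    using AB(2) by blast
  with AB show ?thesis
    by (intro that[of A]) (auto simp: clopenin_def disjnt_iff)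
qed

text \<open>Disjoint neighbourhoods of \<open>f x\<close> and \<open>g x\<close> are pulled back to
  \<open>x\<close>, and a clopen set is chosen inside. This is used with \<open>g\<close> the
  identity or an involution, so that a map displaces a whole clopen set and not just one
  point.\<close>

lemma cantor_separating_clopen:
  assumes X: "cantor_space X" and U: "openin X U" "x \<in> U"
    and f: "continuous_map X X f" and g: "continuous_map X X g" and ne: "f x \<noteq> g x"
  obtains A where "clopenin X A" "x \<in> A" "A \<subseteq> U" "\<And>a b. a \<in> A \<Longrightarrow> b \<in> A \<Longrightarrow> f a \<noteq> g b"
proof -
  have H: "Hausdorff_space X"
    using X metrizable_imp_Hausdorff_space by (auto simp: cantor_space_def)
  have "x \<in> topspace X"
    using U openin_subset by blast
  then have "f x \<in> topspace X" "g x \<in> topspace X"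
    using f g by (auto simp: continuous_map_def)
  then obtain V W where VW: "openin X V" "openin X W" "f x \<in> V" "g x \<in> W" "disjnt V W"
    using H ne unfolding Hausdorff_space_def by metis
  have "openin X ({x \<in> U. f x \<in> V} \<inter> {x \<in> U. g x \<in> W})"
    using VW U f g by (intro openin_Int openin_continuous_map_preimage_gen)
  then obtain A where "clopenin X A" "x \<in> A" "A \<subseteq> {x \<in> U. f x \<in> V} \<inter> {x \<in> U. g x \<in> W}"
    by (rule cantor_clopen_base[OF X]) (use U VW in auto)
  then show ?thesis
    using VW by (intro that[of A]) (force simp: disjnt_iff)+
qed

section \<open>Subsets defined by commutation, and their transport along isomorphisms\<close>

definition commutant :: "('g, 'm) monoid_scheme \<Rightarrow> 'g set \<Rightarrow> 'g set" where
  "commutant G S = {\<gamma> \<in> carrier G. \<forall>\<sigma>\<in>S. \<gamma> \<otimes>\<^bsub>G\<^esub> \<sigma> = \<sigma> \<otimes>\<^bsub>G\<^esub> \<gamma>}"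

text \<open>Below, \<open>\<rho>\<close> is the conjugate of \<open>\<sigma>\<close> by \<open>\<gamma>\<close>.\<close>

definition splitters :: "('g, 'm) monoid_scheme \<Rightarrow> 'g \<Rightarrow> 'g set" where
  "splitters G \<tau> = {\<sigma> \<in> commutant G {\<tau>}. \<sigma> \<otimes>\<^bsub>G\<^esub> \<sigma> = \<one>\<^bsub>G\<^esub> \<and>
     (\<forall>\<gamma>\<in>commutant G {\<tau>}. \<forall>\<rho>\<in>carrier G.
        \<rho> \<otimes>\<^bsub>G\<^esub> \<gamma> = \<gamma> \<otimes>\<^bsub>G\<^esub> \<sigma> \<longrightarrow> \<rho> \<otimes>\<^bsub>G\<^esub> \<sigma> = \<sigma> \<otimes>\<^bsub>G\<^esub> \<rho>)}"

text \<open>Squares are taken because the inner commutant is not trivial on the support: it contains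
  \<tau> itself whenever \<tau> is in the group.\<close>

definition local_subgroup :: "('g, 'm) monoid_scheme \<Rightarrow> 'g \<Rightarrow> 'g set" where
  "local_subgroup G \<tau> = commutant G ((\<lambda>\<gamma>. \<gamma> \<otimes>\<^bsub>G\<^esub> \<gamma>) ` commutant G (splitters G \<tau>))"

lemma commutant_carrier: "commutant G S \<subseteq> carrier G"
  by (auto simp: commutant_def)

lemma splitters_carrier: "splitters G \<tau> \<subseteq> carrier G"
  using commutant_carrier by (fastforce simp: splitters_def)

text \<open>The relations defining commutants and splitters all equate two products of two elements,
  so this single equivalence transports commutation, conjugation and, with \<open>1 * 1\<close> on
  the right, being an involution.\<close>

lemma iso_mult_eq_iff:
  assumes "group G" "h \<in> iso G H" "a \<in> carrier G" "b \<in> carrier G" "c \<in> carrier G" "d \<in> carrier G"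
  shows "h a \<otimes>\<^bsub>H\<^esub> h b = h c \<otimes>\<^bsub>H\<^esub> h d \<longleftrightarrow> a \<otimes>\<^bsub>G\<^esub> b = c \<otimes>\<^bsub>G\<^esub> d"
proof -
  interpret group G by fact
  have "inj_on h (carrier G)" "h \<in> hom G H"
    using assms by (auto simp: iso_def bij_betw_def)
  then show ?thesis
    using assms by (metis hom_mult inj_on_eq_iff m_closed)
qed

lemma commutant_iso:
  assumes "group G" "h \<in> iso G H" "S \<subseteq> carrier G"
  shows "commutant H (h ` S) = h ` commutant G S"
proof -
  have H: "carrier H = h ` carrier G"
    using assms(2) by (auto simp: iso_def bij_betw_def)
  have "h \<gamma> \<otimes>\<^bsub>H\<^esub> h \<sigma> = h \<sigma> \<otimes>\<^bsub>H\<^esub> h \<gamma> \<longleftrightarrow> \<gamma> \<otimes>\<^bsub>G\<^esub> \<sigma> = \<sigma> \<otimes>\<^bsub>G\<^esub> \<gamma>"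
    if "\<gamma> \<in> carrier G" "\<sigma> \<in> S" for \<gamma> \<sigma>
    using that assms by (intro iso_mult_eq_iff[OF assms(1,2)]) auto
  then show ?thesis
    unfolding commutant_def H by auto
qed

lemma splitters_iso:
  assumes G: "group G" and K: "group H" and h: "h \<in> iso G H" and t: "\<tau> \<in> carrier G"
  shows "splitters H (h \<tau>) = h ` splitters G \<tau>"
proof -
  interpret G: group G by fact
  interpret H: group H by fact
  have H: "carrier H = h ` carrier G"
    using h by (auto simp: iso_def bij_betw_def)
  have C: "commutant H {h \<tau>} = h ` commutant G {\<tau>}"
    using commutant_iso[OF G h, of "{\<tau>}"] t by simp
  have inC: "\<sigma> \<in> carrier G" if "\<sigma> \<in> commutant G {\<tau>}" for \<sigma>
    using that subsetD[OF commutant_carrier] by metis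
  have one: "\<one>\<^bsub>H\<^esub> = h \<one>\<^bsub>G\<^esub>"
    using hom_one[of h G H] h G K by (simp add: iso_def)
  have sq: "h \<sigma> \<otimes>\<^bsub>H\<^esub> h \<sigma> = h \<one>\<^bsub>G\<^esub> \<longleftrightarrow> \<sigma> \<otimes>\<^bsub>G\<^esub> \<sigma> = \<one>\<^bsub>G\<^esub>" if "\<sigma> \<in> carrier G" for \<sigma>
    using iso_mult_eq_iff[OF G h that that G.one_closed G.one_closed] one H that
    by simp (metis H.l_one H.one_closed)
  note eq = iso_mult_eq_iff[OF G h]
  \<comment> \<open>The carrier of \<open>H\<close> and the commutant of \<open>h \<tau>\<close> are
    images under \<open>h\<close>, so the quantifiers on the \<open>H\<close> side may range over
    preimages in \<open>G\<close>.\<close>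
  have "h \<sigma> \<otimes>\<^bsub>H\<^esub> h \<sigma> = h \<one>\<^bsub>G\<^esub> \<and> (\<forall>\<gamma>\<in>commutant G {\<tau>}. \<forall>\<rho>\<in>carrier G.
        h \<rho> \<otimes>\<^bsub>H\<^esub> h \<gamma> = h \<gamma> \<otimes>\<^bsub>H\<^esub> h \<sigma> \<longrightarrow> h \<rho> \<otimes>\<^bsub>H\<^esub> h \<sigma> = h \<sigma> \<otimes>\<^bsub>H\<^esub> h \<rho>) \<longleftrightarrow>
      \<sigma> \<otimes>\<^bsub>G\<^esub> \<sigma> = \<one>\<^bsub>G\<^esub> \<and> (\<forall>\<gamma>\<in>commutant G {\<tau>}. \<forall>\<rho>\<in>carrier G.
        \<rho> \<otimes>\<^bsub>G\<^esub> \<gamma> = \<gamma> \<otimes>\<^bsub>G\<^esub> \<sigma> \<longrightarrow> \<rho> \<otimes>\<^bsub>G\<^esub> \<sigma> = \<sigma> \<otimes>\<^bsub>G\<^esub> \<rho>)"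
    if "\<sigma> \<in> commutant G {\<tau>}" for \<sigma>
    using sq[OF inC[OF that]] eq inC that by auto
  then have "h \<sigma> \<in> splitters H (h \<tau>) \<longleftrightarrow> \<sigma> \<in> splitters G \<tau>" if "\<sigma> \<in> commutant G {\<tau>}" for \<sigma>
    using that unfolding splitters_def C H one by simp
  \<comment> \<open>The equivalence was shown only for members of the commutant of \<tau>; these
    inclusions confine both sides of the goal to it.\<close>
  moreover have "splitters G \<tau> \<subseteq> commutant G {\<tau>}" "splitters H (h \<tau>) \<subseteq> h ` commutant G {\<tau>}"
    unfolding C[symmetric] by (auto simp: splitters_def)
  ultimately show ?thesis
    by blast
qed

lemma local_subgroup_iso:
  assumes G: "group G" and H: "group H" and h: "h \<in> iso G H" and t: "\<tau> \<in> carrier G"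
  shows "local_subgroup H (h \<tau>) = h ` local_subgroup G \<tau>"
proof -
  interpret G: group G by fact
  have sq: "h \<gamma> \<otimes>\<^bsub>H\<^esub> h \<gamma> = h (\<gamma> \<otimes>\<^bsub>G\<^esub> \<gamma>)" if "\<gamma> \<in> commutant G S" for \<gamma> S
    using that h by (auto simp: commutant_def iso_def hom_mult)
  have "(\<lambda>\<gamma>. \<gamma> \<otimes>\<^bsub>H\<^esub> \<gamma>) ` h ` commutant G (splitters G \<tau>)
      = h ` (\<lambda>\<gamma>. \<gamma> \<otimes>\<^bsub>G\<^esub> \<gamma>) ` commutant G (splitters G \<tau>)"
    unfolding image_image using sq by (rule image_cong[OF refl])
  moreover have "(\<lambda>\<gamma>. \<gamma> \<otimes>\<^bsub>G\<^esub> \<gamma>) ` commutant G (splitters G \<tau>) \<subseteq> carrier G"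
    by (auto simp: commutant_def)
  ultimately show ?thesis
    unfolding local_subgroup_def splitters_iso[OF G H h t]
      commutant_iso[OF G h splitters_carrier]
    by (simp add: commutant_iso[OF G h])
qed

section \<open>Pointwise calculus of group elements and supports\<close>

locale cantor_class_F = class_F +
  assumes cantor: "cantor_space X"
begin

text \<open>The carrier is cut down to \<Gamma> so that commutants range over \<Gamma> and not over
  all homeomorphisms; only then does an isomorphism of the two given groups respect them.\<close>

abbreviation "\<G> \<equiv> (Homeo X)\<lparr>carrier := \<Gamma>\<rparr>"

sublocale G: group \<G>
  by (rule subgroup.subgroup_is_group[OF subgroup_axioms group_Homeo])

lemma elem_homeo: "\<alpha> \<in> \<Gamma> \<Longrightarrow> homeomorphic_map X X \<alpha>"
  using subset by (auto simp: Homeo_def)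

lemma elem_extensional: "\<alpha> \<in> \<Gamma> \<Longrightarrow> \<alpha> \<in> extensional (topspace X)"
  using subset by (auto simp: Homeo_def Bij_def)

lemma elem_continuous: "\<alpha> \<in> \<Gamma> \<Longrightarrow> continuous_map X X \<alpha>"
  using elem_homeo homeomorphic_imp_continuous_map by blast

lemma elem_in: "\<alpha> \<in> \<Gamma> \<Longrightarrow> x \<in> topspace X \<Longrightarrow> \<alpha> x \<in> topspace X"
  using elem_continuous[of \<alpha>] by (auto simp: continuous_map_def)

lemma elem_inj: "\<alpha> \<in> \<Gamma> \<Longrightarrow> x \<in> topspace X \<Longrightarrow> y \<in> topspace X \<Longrightarrow> \<alpha> x = \<alpha> y \<longleftrightarrow> x = y"
  using homeomorphic_imp_injective_map[OF elem_homeo] inj_on_eq_iff by metis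

lemma elem_surj:
  assumes "\<alpha> \<in> \<Gamma>" "y \<in> topspace X"
  obtains x where "x \<in> topspace X" "y = \<alpha> x"
  using assms homeomorphic_imp_surjective_map[OF elem_homeo[OF assms(1)]] by blast

lemma mult_apply:
  "\<alpha> \<in> \<Gamma> \<Longrightarrow> \<beta> \<in> \<Gamma> \<Longrightarrow> x \<in> topspace X \<Longrightarrow> (\<alpha> \<otimes>\<^bsub>Homeo X\<^esub> \<beta>) x = \<alpha> (\<beta> x)"
  using subset by (subst mult_Homeo) (auto simp: compose_def)

lemma one_apply: "x \<in> topspace X \<Longrightarrow> \<one>\<^bsub>Homeo X\<^esub> x = x"
  by (simp add: one_Homeo)

lemma elem_eq_iff: "\<alpha> \<in> \<Gamma> \<Longrightarrow> \<beta> \<in> \<Gamma> \<Longrightarrow> \<alpha> = \<beta> \<longleftrightarrow> (\<forall>x\<in>topspace X. \<alpha> x = \<beta> x)"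
  using elem_extensional[of \<alpha>] elem_extensional[of \<beta>] extensionalityI by metis

text \<open>Four independent factors let the same rule unfold commutation and the inverse-free
  conjugation relation \<open>\<rho> \<gamma> = \<gamma> \<sigma>\<close>.\<close>

lemma commute_iff:
  "\<alpha> \<in> \<Gamma> \<Longrightarrow> \<beta> \<in> \<Gamma> \<Longrightarrow> \<gamma> \<in> \<Gamma> \<Longrightarrow> \<delta> \<in> \<Gamma> \<Longrightarrow>
    \<alpha> \<otimes>\<^bsub>Homeo X\<^esub> \<beta> = \<gamma> \<otimes>\<^bsub>Homeo X\<^esub> \<delta> \<longleftrightarrow> (\<forall>x\<in>topspace X. \<alpha> (\<beta> x) = \<gamma> (\<delta> x))"
  using elem_eq_iff[of "\<alpha> \<otimes>\<^bsub>Homeo X\<^esub> \<beta>" "\<gamma> \<otimes>\<^bsub>Homeo X\<^esub> \<delta>"] by (simp add: mult_apply)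

lemma involution_iff:
  "\<alpha> \<in> \<Gamma> \<Longrightarrow> \<alpha> \<otimes>\<^bsub>Homeo X\<^esub> \<alpha> = \<one>\<^bsub>Homeo X\<^esub> \<longleftrightarrow> (\<forall>x\<in>topspace X. \<alpha> (\<alpha> x) = x)"
  using elem_eq_iff[of "\<alpha> \<otimes>\<^bsub>Homeo X\<^esub> \<alpha>" "\<one>\<^bsub>Homeo X\<^esub>"] by (simp add: mult_apply one_apply)

lemma supp_subset: "supp X \<alpha> \<subseteq> topspace X"
  by (simp add: supp_def closure_of_subset_topspace)

lemma fixed_outside_supp: "x \<in> topspace X \<Longrightarrow> x \<notin> supp X \<alpha> \<Longrightarrow> \<alpha> x = x"
  using closure_of_subset[of "{x \<in> topspace X. \<alpha> x \<noteq> x}" X] by (auto simp: supp_def)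

lemma moved_in_supp: "x \<in> topspace X \<Longrightarrow> \<alpha> x \<noteq> x \<Longrightarrow> x \<in> supp X \<alpha>"
  using fixed_outside_supp by metis

lemma supp_minimal:
  "closedin X C \<Longrightarrow> (\<And>x. x \<in> topspace X \<Longrightarrow> \<alpha> x \<noteq> x \<Longrightarrow> x \<in> C) \<Longrightarrow> supp X \<alpha> \<subseteq> C"
  unfolding supp_def by (rule closure_of_minimal) auto

lemma supp_closed: "closedin X (supp X \<alpha>)"
  by (simp add: supp_def)

text \<open>The relation says that \<tau> is the conjugate of \<sigma> by \<alpha>. Hence \<alpha>
  maps the points moved by \<sigma> onto those moved by \<tau>, and a homeomorphism commutes with
  closure.\<close>

lemma supp_conjugate:
  assumes "\<alpha> \<in> \<Gamma>" "\<sigma> \<in> \<Gamma>" "\<tau> \<in> \<Gamma>" and eq: "\<alpha> \<otimes>\<^bsub>Homeo X\<^esub> \<sigma> = \<tau> \<otimes>\<^bsub>Homeo X\<^esub> \<alpha>"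
    and x: "x \<in> topspace X"
  shows "\<alpha> x \<in> supp X \<tau> \<longleftrightarrow> x \<in> supp X \<sigma>"
proof -
  have c: "\<alpha> (\<sigma> z) = \<tau> (\<alpha> z)" if "z \<in> topspace X" for z
    using eq assms(1-3) that by (simp add: commute_iff)
  have "{z \<in> topspace X. \<tau> z \<noteq> z} = \<alpha> ` {z \<in> topspace X. \<sigma> z \<noteq> z}"
    (is "?L = ?R")
  proof
    show "?L \<subseteq> ?R"
    proof
      fix z assume z: "z \<in> ?L"
      then obtain w where w: "w \<in> topspace X" "z = \<alpha> w"
        using elem_surj assms(1) by blast
      with z c[of w] have "\<sigma> w \<noteq> w" by auto
      with w show "z \<in> ?R" by blast
    qed
    show "?R \<subseteq> ?L"
    proof
      fix z assume "z \<in> ?R"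
      then obtain w where w: "w \<in> topspace X" "z = \<alpha> w" "\<sigma> w \<noteq> w"
        by blast
      then have "\<alpha> (\<sigma> w) \<noteq> \<alpha> w" "\<alpha> w \<in> topspace X"
        using elem_inj[OF assms(1)] elem_in[OF assms(1)] elem_in[OF assms(2)] by auto
      then show "z \<in> ?L"
        using c[OF w(1)] w(2) by simp
    qed
  qed
  then have "supp X \<tau> = \<alpha> ` supp X \<sigma>"
    unfolding supp_def using homeomorphic_map_closure_of[OF elem_homeo[OF assms(1)]] by simp
  then show ?thesis
    using inj_on_image_mem_iff[OF homeomorphic_imp_injective_map[OF elem_homeo[OF assms(1)]] x supp_subset]
    by simp
qed

lemma supp_invariant:
  "\<alpha> \<in> \<Gamma> \<Longrightarrow> x \<in> topspace X \<Longrightarrow> \<alpha> x \<in> supp X \<alpha> \<longleftrightarrow> x \<in> supp X \<alpha>"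
  using supp_conjugate[of \<alpha> \<alpha> \<alpha>] by simp

lemma supp_empty_iff: "\<alpha> \<in> \<Gamma> \<Longrightarrow> supp X \<alpha> = {} \<longleftrightarrow> \<alpha> = \<one>\<^bsub>Homeo X\<^esub>"
proof
  assume "\<alpha> \<in> \<Gamma>" "supp X \<alpha> = {}"
  then show "\<alpha> = \<one>\<^bsub>Homeo X\<^esub>"
    by (subst elem_eq_iff) (auto simp: one_apply fixed_outside_supp[of _ \<alpha>])
next
  assume "\<alpha> = \<one>\<^bsub>Homeo X\<^esub>"
  then show "supp X \<alpha> = {}"
    using supp_minimal[of "{}" \<alpha>] by (auto simp: one_apply)
qed

text \<open>Each map preserves its own support, so a point moved by one of them stays where the
  other is the identity.\<close>

lemma disjoint_supp_commute:
  assumes "\<alpha> \<in> \<Gamma>" "\<beta> \<in> \<Gamma>" and disj: "supp X \<alpha> \<inter> supp X \<beta> = {}"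
  shows "\<alpha> \<otimes>\<^bsub>Homeo X\<^esub> \<beta> = \<beta> \<otimes>\<^bsub>Homeo X\<^esub> \<alpha>"
proof (subst commute_iff[OF assms(1,2,2,1)], intro ballI)
  fix x assume x: "x \<in> topspace X"
  consider "x \<in> supp X \<alpha>" "x \<notin> supp X \<beta>" | "x \<notin> supp X \<alpha>"
    using disj by blast
  then show "\<alpha> (\<beta> x) = \<beta> (\<alpha> x)"
  proof cases
    case 1
    then have "\<alpha> x \<notin> supp X \<beta>"
      using disj supp_invariant[OF assms(1) x] by blast
    then show ?thesis
      using 1 x elem_in[OF assms(1)] by (simp add: fixed_outside_supp[of _ \<beta>])
  next
    case 2
    then have "\<beta> x \<notin> supp X \<alpha> \<or> \<beta> x = x"
      using disj supp_invariant[OF assms(2) x] fixed_outside_supp[OF x, of \<beta>] by blast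
    then show ?thesis
      using 2 x elem_in[OF assms(2)] by (auto simp: fixed_outside_supp[of _ \<alpha>])
  qed
qed

section \<open>Recognizing the elements supported in the support of an involution\<close>

text \<open>Source of the test elements in the next two contradictions, with \<open>K\<close> the
  support of \<tau>. Continuity gives a clopen \<open>A\<close> off \<open>K\<close> that \<sigma>
  moves off itself, and F3 gives a non-involution supported in \<open>A\<close>.\<close>

lemma displaced_local_nonsquare:
  assumes "\<sigma> \<in> \<Gamma>" "closedin X K" "x \<in> topspace X" "x \<notin> K" "\<sigma> x \<noteq> x"
  obtains A \<gamma> y where "\<gamma> \<in> \<Gamma>" "supp X \<gamma> \<subseteq> A" "A \<inter> K = {}" "A \<subseteq> topspace X"
    "\<And>a. a \<in> A \<Longrightarrow> \<sigma> a \<notin> A" "y \<in> A" "\<gamma> y \<in> A" "\<gamma> (\<gamma> y) \<noteq> y"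
proof -
  obtain A where A: "clopenin X A" "x \<in> A" "A \<subseteq> topspace X - K"
      "\<And>a b. a \<in> A \<Longrightarrow> b \<in> A \<Longrightarrow> \<sigma> a \<noteq> id b"
    using cantor_separating_clopen[OF cantor, of "topspace X - K" x \<sigma> id]
      elem_continuous[OF assms(1)] assms by auto
  then obtain \<gamma> where \<gamma>: "\<gamma> \<in> \<Gamma>" "supp X \<gamma> \<subseteq> A" "\<gamma> \<otimes>\<^bsub>Homeo X\<^esub> \<gamma> \<noteq> \<one>\<^bsub>Homeo X\<^esub>"
    using F3 by blast
  then obtain y where y: "y \<in> topspace X" "\<gamma> (\<gamma> y) \<noteq> y"
    using involution_iff by blast
  then have "y \<in> supp X \<gamma>"
    using moved_in_supp[OF y(1), of \<gamma>] y(2) by metis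
  moreover from this have "\<gamma> y \<in> supp X \<gamma>"
    using supp_invariant \<gamma>(1) y(1) by blast
  ultimately show ?thesis
    using that[of \<gamma> A y] \<gamma> A y by auto
qed

text \<open>If \<sigma> moved a point off the support of \<tau>, a test element \<gamma> living
  there would commute with \<tau>. Then \<sigma> would have to commute with its conjugate by
  \<gamma>, which forces \<gamma> to square to the identity at \<open>y\<close>.\<close>

lemma splitters_supp:
  assumes \<tau>: "\<tau> \<in> \<Gamma>" and \<sigma>: "\<sigma> \<in> splitters \<G> \<tau>"
  shows "supp X \<sigma> \<subseteq> supp X \<tau>"
proof (rule supp_minimal[OF supp_closed], rule ccontr)
  fix x assume x: "x \<in> topspace X" "\<sigma> x \<noteq> x" "x \<notin> supp X \<tau>"
  have \<sigma>\<Gamma>: "\<sigma> \<in> \<Gamma>"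
    using \<sigma> splitters_carrier by fastforce
  obtain A \<gamma> y where A: "\<gamma> \<in> \<Gamma>" "supp X \<gamma> \<subseteq> A" "A \<inter> supp X \<tau> = {}" "A \<subseteq> topspace X"
      "\<And>a. a \<in> A \<Longrightarrow> \<sigma> a \<notin> A" and y: "y \<in> A" "\<gamma> y \<in> A" "\<gamma> (\<gamma> y) \<noteq> y"
    using displaced_local_nonsquare[OF \<sigma>\<Gamma> supp_closed x(1,3,2)] by metis
  have "\<gamma> \<in> commutant \<G> {\<tau>}"
    using A \<tau> disjoint_supp_commute[of \<gamma> \<tau>] by (auto simp: commutant_def)
  moreover define \<rho> where "\<rho> = (\<gamma> \<otimes>\<^bsub>\<G>\<^esub> \<sigma>) \<otimes>\<^bsub>\<G>\<^esub> inv\<^bsub>\<G>\<^esub> \<gamma>"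
  have c: "\<gamma> \<in> carrier \<G>" "\<sigma> \<in> carrier \<G>"
    using A(1) \<sigma>\<Gamma> by auto
  then have \<rho>: "\<rho> \<in> carrier \<G>" "\<rho> \<otimes>\<^bsub>\<G>\<^esub> \<gamma> = \<gamma> \<otimes>\<^bsub>\<G>\<^esub> \<sigma>"
    unfolding \<rho>_def using G.inv_closed G.m_closed G.m_assoc G.l_inv G.r_one by metis+
  ultimately have "\<rho> \<otimes>\<^bsub>\<G>\<^esub> \<sigma> = \<sigma> \<otimes>\<^bsub>\<G>\<^esub> \<rho>"
    using \<sigma> by (auto simp: splitters_def)
  then have c1: "\<rho> (\<sigma> z) = \<sigma> (\<rho> z)" if "z \<in> topspace X" for z
    using \<rho>(1) \<sigma>\<Gamma> that by (simp add: commute_iff)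
  have c2: "\<rho> (\<gamma> z) = \<gamma> (\<sigma> z)" if "z \<in> topspace X" for z
    using \<rho> \<sigma>\<Gamma> A(1) that by (simp add: commute_iff)
  have inv: "\<sigma> (\<sigma> z) = z" if "z \<in> topspace X" for z
    using \<sigma> \<sigma>\<Gamma> that by (simp add: splitters_def involution_iff)
  \<comment> \<open>\<sigma> throws \<open>A\<close> off itself, and \<gamma> is the identity
    outside \<open>A\<close>.\<close>
  have fix\<gamma>: "\<gamma> (\<sigma> a) = \<sigma> a" if "a \<in> A" for a
    using A that elem_in[OF \<sigma>\<Gamma>] by (intro fixed_outside_supp) auto
  have top: "y \<in> topspace X" "\<gamma> y \<in> topspace X" "\<sigma> (\<gamma> y) \<in> topspace X"
    using y A elem_in[OF \<sigma>\<Gamma>] by auto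
  \<comment> \<open>The two orders of \<rho> and \<sigma> are compared at \<open>\<gamma> y\<close>:
    one gives \<open>\<gamma> (\<gamma> y)\<close>, the other gives \<open>y\<close>.\<close>
  have "\<gamma> (\<gamma> y) = \<gamma> (\<sigma> (\<sigma> (\<gamma> y)))"
    using inv top by simp
  also have "\<dots> = \<rho> (\<sigma> (\<gamma> y))"
    using c2[of "\<sigma> (\<gamma> y)"] top fix\<gamma>[OF y(2)] by simp
  also have "\<dots> = \<sigma> (\<gamma> (\<sigma> y))"
    using c1 c2 top by simp
  also have "\<dots> = y"
    using fix\<gamma>[OF y(1)] inv top by simp
  finally show False
    using y(3) by simp
qed

text \<open>A test element \<gamma> living off the support of \<tau> commutes with all splitters,
  since these are supported inside it. So \<delta> commutes with the square of \<gamma>, although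
  \<delta> carries \<open>y\<close> to a point fixed by \<gamma> while the square moves
  \<open>y\<close>.\<close>

lemma local_subgroup_supp:
  assumes \<tau>: "\<tau> \<in> \<Gamma>" and \<delta>: "\<delta> \<in> local_subgroup \<G> \<tau>"
  shows "supp X \<delta> \<subseteq> supp X \<tau>"
proof (rule supp_minimal[OF supp_closed], rule ccontr)
  fix x assume x: "x \<in> topspace X" "\<delta> x \<noteq> x" "x \<notin> supp X \<tau>"
  have \<delta>\<Gamma>: "\<delta> \<in> \<Gamma>"
    using \<delta> by (simp add: local_subgroup_def commutant_def)
  obtain A \<gamma> y where A: "\<gamma> \<in> \<Gamma>" "supp X \<gamma> \<subseteq> A" "A \<inter> supp X \<tau> = {}" "A \<subseteq> topspace X"
      "\<And>a. a \<in> A \<Longrightarrow> \<delta> a \<notin> A" and y: "y \<in> A" "\<gamma> y \<in> A" "\<gamma> (\<gamma> y) \<noteq> y"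
    using displaced_local_nonsquare[OF \<delta>\<Gamma> supp_closed x(1,3,2)] by metis
  have "\<gamma> \<otimes>\<^bsub>\<G>\<^esub> \<sigma> = \<sigma> \<otimes>\<^bsub>\<G>\<^esub> \<gamma>" if "\<sigma> \<in> splitters \<G> \<tau>" for \<sigma>
  proof -
    have "supp X \<gamma> \<inter> supp X \<sigma> = {}" "\<sigma> \<in> \<Gamma>"
      using splitters_supp[OF \<tau> that] A that splitters_carrier by fastforce+
    then show ?thesis
      using A disjoint_supp_commute by simp
  qed
  then have "\<gamma> \<in> commutant \<G> (splitters \<G> \<tau>)"
    using A by (simp add: commutant_def)
  then have "\<delta> \<otimes>\<^bsub>\<G>\<^esub> (\<gamma> \<otimes>\<^bsub>\<G>\<^esub> \<gamma>) = (\<gamma> \<otimes>\<^bsub>\<G>\<^esub> \<gamma>) \<otimes>\<^bsub>\<G>\<^esub> \<delta>"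
    using \<delta> by (auto simp: local_subgroup_def commutant_def)
  moreover have "\<gamma> \<otimes>\<^bsub>Homeo X\<^esub> \<gamma> \<in> \<Gamma>" "y \<in> topspace X"
    using A y by auto
  ultimately have "\<delta> (\<gamma> (\<gamma> y)) = \<gamma> (\<gamma> (\<delta> y))"
    using A \<delta>\<Gamma> elem_in by (simp add: commute_iff mult_apply)
  moreover have "\<gamma> (\<delta> y) = \<delta> y"
    using A y elem_in[OF \<delta>\<Gamma>] by (intro fixed_outside_supp) auto
  ultimately show False
    using y(3) elem_inj[OF \<delta>\<Gamma>] elem_in[OF A(1)] \<open>y \<in> topspace X\<close> by simp
qed

text \<open>Such a \<beta> is \<tau> on a \<tau>-invariant set and the identity elsewhere.
  Conjugating by an element that commutes with \<tau> only changes the set, and any two maps of this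
  shape commute.\<close>

lemma restriction_splitter:
  assumes \<tau>: "\<tau> \<in> \<Gamma>" "\<tau> \<otimes>\<^bsub>Homeo X\<^esub> \<tau> = \<one>\<^bsub>Homeo X\<^esub>"
    and \<beta>: "\<beta> \<in> \<Gamma>" "\<And>x. x \<in> supp X \<beta> \<Longrightarrow> \<beta> x = \<tau> x"
  shows "\<beta> \<in> splitters \<G> \<tau>"
proof -
  have tt: "\<tau> (\<tau> x) = x" if "x \<in> topspace X" for x
    using \<tau> that by (simp add: involution_iff)
  have \<tau>inv: "\<tau> x \<in> supp X \<beta> \<longleftrightarrow> x \<in> supp X \<beta>" if "x \<in> topspace X" for x
    using supp_invariant[OF \<beta>(1)] \<beta>(2) that tt elem_in[OF \<tau>(1)] by metis
  have \<beta>val: "\<beta> x = (if x \<in> supp X \<beta> then \<tau> x else x)" if "x \<in> topspace X" for x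
    using \<beta>(2) fixed_outside_supp[OF that, of \<beta>] by auto
  have "\<beta> \<in> commutant \<G> {\<tau>}"
    using \<beta>(1) \<tau>(1) elem_in[OF \<tau>(1)] \<tau>inv by (simp add: commutant_def commute_iff \<beta>val)
  moreover have "\<beta> \<otimes>\<^bsub>\<G>\<^esub> \<beta> = \<one>\<^bsub>\<G>\<^esub>"
    using \<beta>(1) tt elem_in[OF \<tau>(1)] \<tau>inv by (simp add: involution_iff \<beta>val)
  moreover have "\<rho> \<otimes>\<^bsub>\<G>\<^esub> \<beta> = \<beta> \<otimes>\<^bsub>\<G>\<^esub> \<rho>"
    if \<gamma>: "\<gamma> \<in> commutant \<G> {\<tau>}" and \<rho>: "\<rho> \<in> carrier \<G>" "\<rho> \<otimes>\<^bsub>\<G>\<^esub> \<gamma> = \<gamma> \<otimes>\<^bsub>\<G>\<^esub> \<beta>" for \<gamma> \<rho>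
  proof -
    have \<gamma>\<Gamma>: "\<gamma> \<in> \<Gamma>" and \<gamma>\<tau>: "\<And>z. z \<in> topspace X \<Longrightarrow> \<gamma> (\<tau> z) = \<tau> (\<gamma> z)"
      using \<gamma> \<tau>(1) by (auto simp: commutant_def commute_iff)
    have \<rho>\<gamma>: "\<rho> (\<gamma> z) = \<gamma> (\<beta> z)" if "z \<in> topspace X" for z
      using \<rho> \<gamma>\<Gamma> \<beta>(1) that by (simp add: commute_iff)
    \<comment> \<open>The set on which the conjugate \<rho> acts as \<tau>.\<close>
    define R where "R = \<gamma> ` supp X \<beta>"
    have \<gamma>R: "\<gamma> z \<in> R \<longleftrightarrow> z \<in> supp X \<beta>" if "z \<in> topspace X" for z
      unfolding R_def using elem_inj[OF \<gamma>\<Gamma>] that supp_subset by (auto simp: subset_iff)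
    have \<rho>val: "\<rho> x = (if x \<in> R then \<tau> x else x)" and \<tau>R: "\<tau> x \<in> R \<longleftrightarrow> x \<in> R"
      if "x \<in> topspace X" for x
    proof -
      obtain z where z: "z \<in> topspace X" "x = \<gamma> z"
        using elem_surj[OF \<gamma>\<Gamma> \<open>x \<in> topspace X\<close>] .
      show "\<rho> x = (if x \<in> R then \<tau> x else x)"
        using z \<rho>\<gamma> \<gamma>R \<gamma>\<tau> \<beta>val by simp
      show "\<tau> x \<in> R \<longleftrightarrow> x \<in> R"
        using z \<gamma>\<tau>[OF z(1), symmetric] \<gamma>R \<tau>inv elem_in[OF \<tau>(1)] by simp
    qed
    have "\<rho> \<in> \<Gamma>"
      using \<rho> by simp
    then show ?thesis
      using \<beta>(1) elem_in[OF \<tau>(1)] \<tau>inv \<tau>R by (simp add: commute_iff \<beta>val \<rho>val)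
  qed
  ultimately show ?thesis
    by (auto simp: splitters_def)
qed

lemma commutant_splitters_orbit:
  assumes \<tau>: "\<tau> \<in> \<Gamma>" "\<tau> \<otimes>\<^bsub>Homeo X\<^esub> \<tau> = \<one>\<^bsub>Homeo X\<^esub>"
    and \<gamma>: "\<gamma> \<in> commutant \<G> (splitters \<G> \<tau>)" and x: "x \<in> supp X \<tau>"
  shows "\<gamma> x = x \<or> \<gamma> x = \<tau> x"
proof (rule ccontr)
  assume neg: "\<not> ?thesis"
  have \<gamma>\<Gamma>: "\<gamma> \<in> \<Gamma>"
    using \<gamma> by (simp add: commutant_def)
  \<comment> \<open>Openness of the support, from F0, leaves room for a clopen neighbourhood of
    \<open>x\<close> inside it, as F2 demands.\<close>
  have op: "openin X (supp X \<tau>)"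
    using F0[OF \<tau>] by (simp add: clopenin_def)
  have "\<gamma> x \<noteq> id x"
    using neg by simp
  then obtain A where A: "clopenin X A" "x \<in> A" "A \<subseteq> supp X \<tau>" "\<And>a b. a \<in> A \<Longrightarrow> b \<in> A \<Longrightarrow> \<gamma> a \<noteq> id b"
    using cantor_separating_clopen[OF cantor op x elem_continuous[OF \<gamma>\<Gamma>] continuous_map_id] by metis
  have "openin X A" "\<gamma> x \<noteq> \<tau> x"
    using neg A(1) by (simp_all add: clopenin_def)
  then obtain B where B: "clopenin X B" "x \<in> B" "B \<subseteq> A" "\<And>a b. a \<in> B \<Longrightarrow> b \<in> B \<Longrightarrow> \<gamma> a \<noteq> \<tau> b"
    using cantor_separating_clopen[OF cantor _ A(2) elem_continuous[OF \<gamma>\<Gamma>] elem_continuous[OF \<tau>(1)]]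
    by metis
  have "\<tau> \<in> \<Gamma> - {\<one>\<^bsub>Homeo X\<^esub>}"
    using \<tau> x supp_empty_iff[OF \<tau>(1)] by auto
  moreover have "B \<noteq> {}" "B \<subseteq> supp X \<tau>"
    using A(3) B(2,3) by auto
  ultimately obtain \<beta> where "\<beta> \<in> \<Gamma> - {\<one>\<^bsub>Homeo X\<^esub>}"
      and \<beta>': "supp X \<beta> \<subseteq> B \<union> \<tau> ` B" "\<forall>x\<in>supp X \<beta>. \<beta> x = \<tau> x"
    using F2[OF _ \<tau>(2) _ B(1)] by metis
  then have \<beta>: "\<beta> \<in> \<Gamma>" "\<beta> \<noteq> \<one>\<^bsub>Homeo X\<^esub>" "supp X \<beta> \<subseteq> B \<union> \<tau> ` B"
      "\<And>x. x \<in> supp X \<beta> \<Longrightarrow> \<beta> x = \<tau> x"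
    by auto
  have spl: "\<beta> \<in> splitters \<G> \<tau>"
    using restriction_splitter[OF \<tau> \<beta>(1,4)] .
  have B': "B \<subseteq> topspace X"
    using A B supp_subset by blast
  obtain y where y: "y \<in> topspace X" "\<beta> y \<noteq> y"
    using \<beta>(1,2) one_apply elem_eq_iff[OF \<beta>(1) one_closed] by auto
  have \<beta>\<beta>: "\<beta> (\<beta> z) = z" if "z \<in> topspace X" for z
    using spl \<beta>(1) that by (simp add: splitters_def involution_iff)
  obtain a where a: "a \<in> B" "\<beta> a \<noteq> a"
  proof (cases "y \<in> B")
    case True
    with y that show ?thesis by blast
  next
    case False
    have ys: "y \<in> supp X \<beta>"
      using moved_in_supp y by blast
    then obtain b where b: "b \<in> B" "y = \<tau> b"
      using \<beta>(3) False by blast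
    then have "\<beta> y = b"
      using \<beta>(4)[OF ys] \<tau> B' by (auto simp: involution_iff)
    then have "\<beta> b \<noteq> b"
      using \<beta>\<beta> y by metis
    with b that show ?thesis by blast
  qed
  have "a \<in> topspace X"
    using a B' by blast
  moreover have "\<gamma> \<otimes>\<^bsub>Homeo X\<^esub> \<beta> = \<beta> \<otimes>\<^bsub>Homeo X\<^esub> \<gamma>"
    using \<gamma> spl by (simp add: commutant_def)
  ultimately have "\<beta> (\<gamma> a) = \<gamma> (\<beta> a)"
    using commute_iff \<gamma>\<Gamma> \<beta>(1) by simp
  then have "\<beta> (\<gamma> a) \<noteq> \<gamma> a"
    using a elem_inj[OF \<gamma>\<Gamma>] elem_in[OF \<beta>(1)] \<open>a \<in> topspace X\<close> by auto
  then have "\<gamma> a \<in> supp X \<beta>"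
    using moved_in_supp elem_in[OF \<gamma>\<Gamma> \<open>a \<in> topspace X\<close>] by blast
  then consider b where "b \<in> B" "\<gamma> a = b" | b where "b \<in> B" "\<gamma> a = \<tau> b"
    using \<beta>(3) by blast
  then show False
    using A(4) B(3,4) a(1) by cases auto
qed

lemma local_subgroup_eq:
  assumes \<tau>: "\<tau> \<in> \<Gamma>" "\<tau> \<otimes>\<^bsub>Homeo X\<^esub> \<tau> = \<one>\<^bsub>Homeo X\<^esub>"
  shows "local_subgroup \<G> \<tau> = {\<delta> \<in> \<Gamma>. supp X \<delta> \<subseteq> supp X \<tau>}"
proof (intro equalityI subsetI)
  fix \<delta> assume "\<delta> \<in> local_subgroup \<G> \<tau>"
  then show "\<delta> \<in> {\<delta> \<in> \<Gamma>. supp X \<delta> \<subseteq> supp X \<tau>}"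
    using local_subgroup_supp[OF \<tau>(1)] by (simp add: local_subgroup_def commutant_def)
next
  fix \<delta> assume \<delta>: "\<delta> \<in> {\<delta> \<in> \<Gamma>. supp X \<delta> \<subseteq> supp X \<tau>}"
  have "\<delta> \<otimes>\<^bsub>\<G>\<^esub> (\<gamma> \<otimes>\<^bsub>\<G>\<^esub> \<gamma>) = (\<gamma> \<otimes>\<^bsub>\<G>\<^esub> \<gamma>) \<otimes>\<^bsub>\<G>\<^esub> \<delta>"
    if \<gamma>: "\<gamma> \<in> commutant \<G> (splitters \<G> \<tau>)" for \<gamma>
  proof -
    have \<gamma>\<Gamma>: "\<gamma> \<in> \<Gamma>" and \<delta>\<Gamma>: "\<delta> \<in> \<Gamma>"
      using \<gamma> \<delta> by (auto simp: commutant_def)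
    \<comment> \<open>By the orbit lemma \<gamma> maps the orbit \<open>{x, \<tau> x}\<close>
      injectively into itself, so it fixes or swaps its points.\<close>
    have sq: "\<gamma> (\<gamma> x) = x" if x: "x \<in> supp X \<tau>" for x
    proof -
      have xt: "x \<in> topspace X" and \<tau>x: "\<tau> x \<in> supp X \<tau>" and \<tau>\<tau>: "\<tau> (\<tau> x) = x"
        using x supp_subset supp_invariant[OF \<tau>(1)] \<tau> by (auto simp: involution_iff)
      note orb = commutant_splitters_orbit[OF \<tau> \<gamma>]
      show ?thesis
        using orb[OF x] orb[OF \<tau>x] \<tau>\<tau> elem_inj[OF \<gamma>\<Gamma> xt] elem_in[OF \<tau>(1) xt] by metis
    qed
    have "\<delta> (\<gamma> (\<gamma> x)) = \<gamma> (\<gamma> (\<delta> x))" if x: "x \<in> topspace X" for x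
    proof (cases "x \<in> supp X \<tau>")
      case True
      have "\<delta> x \<in> supp X \<tau>"
        using True \<delta> supp_invariant[OF \<delta>\<Gamma> x] fixed_outside_supp[OF x, of \<delta>] by auto
      then show ?thesis
        using True sq by simp
    next
      case False
      have t: "\<gamma> x \<in> topspace X" "\<gamma> (\<gamma> x) \<in> topspace X"
        using elem_in[OF \<gamma>\<Gamma>] x by auto
      \<comment> \<open>The square of \<gamma> already fixes each point of the support, so
        injectivity keeps outside points outside.\<close>
      have "\<gamma> (\<gamma> x) \<notin> supp X \<tau>"
        using sq[of "\<gamma> (\<gamma> x)"] elem_inj[OF \<gamma>\<Gamma>] x t elem_in[OF \<gamma>\<Gamma>] False by metis
      then have "\<gamma> (\<gamma> x) \<notin> supp X \<delta>" "x \<notin> supp X \<delta>"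
        using False \<delta> by auto
      then show ?thesis
        using fixed_outside_supp[OF x, of \<delta>] fixed_outside_supp[OF t(2), of \<delta>] by simp
    qed
    then show ?thesis
      using \<gamma>\<Gamma> \<delta>\<Gamma> elem_in by (simp add: commute_iff mult_apply)
  qed
  with \<delta> show "\<delta> \<in> local_subgroup \<G> \<tau>"
    by (auto simp: local_subgroup_def commutant_def)
qed

lemma involution_base:
  assumes "openin X U" "x \<in> U"
  obtains \<tau> where "\<tau> \<in> \<Gamma>" "\<tau> \<otimes>\<^bsub>Homeo X\<^esub> \<tau> = \<one>\<^bsub>Homeo X\<^esub>" "x \<in> supp X \<tau>" "supp X \<tau> \<subseteq> U"
proof -
  obtain A where "clopenin X A" "x \<in> A" "A \<subseteq> U"
    using cantor_clopen_base[OF cantor assms] .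
  then show ?thesis
    using F1[of x A] that by blast
qed

end

section \<open>Homeomorphisms from matching clopen bases\<close>

text \<open>Indexing by a set \<open>I\<close> lets one set of involutions label bases of both
  spaces, so matching sets share an index. Repetitions are allowed, as distinct involutions can have
  equal supports.\<close>

definition clopen_base :: "'i set \<Rightarrow> 'a topology \<Rightarrow> ('i \<Rightarrow> 'a set) \<Rightarrow> bool" where
  "clopen_base I X B \<longleftrightarrow> (\<forall>i\<in>I. clopenin X (B i)) \<and>
     (\<forall>U x. openin X U \<and> x \<in> U \<longrightarrow> (\<exists>i\<in>I. x \<in> B i \<and> B i \<subseteq> U))"

lemma clopen_base_clopen:
  assumes "clopen_base I X B" "i \<in> I"
  shows "closedin X (B i)" "openin X (B i)"
  using assms by (auto simp: clopen_base_def clopenin_def)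

lemma clopen_base_nbhd:
  assumes "clopen_base I X B" "openin X U" "x \<in> U"
  obtains i where "i \<in> I" "x \<in> B i" "B i \<subseteq> U"
  using assms unfolding clopen_base_def by blast

text \<open>Hausdorffness puts a basic set around \<open>x\<close> that misses a different
  \<open>y\<close>. Equalities of points, for the inverse maps and for equivariance, are checked
  this way.\<close>

lemma clopen_base_separates:
  assumes "clopen_base I X B" "Hausdorff_space X" "x \<in> topspace X" "y \<in> topspace X"
    and "\<And>i. i \<in> I \<Longrightarrow> x \<in> B i \<longleftrightarrow> y \<in> B i"
  shows "x = y"
proof (rule ccontr)
  assume "x \<noteq> y"
  then obtain U V where "openin X U" "x \<in> U" "y \<in> V" "disjnt U V"
    using assms unfolding Hausdorff_space_def by metis
  then obtain i where "i \<in> I" "x \<in> B i" "B i \<subseteq> U" "y \<notin> U"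
    using assms(1) by (metis clopen_base_def disjnt_iff)
  then show False
    using assms(5) by blast
qed

text \<open>The sets \<open>C i\<close> with \<open>x\<close> in \<open>B i\<close> have the finite
  intersection property, so compactness provides \<open>y\<close>. Conversely, if \<open>y\<close>
  lay in \<open>C i\<close> with \<open>x\<close> outside \<open>B i\<close>, a basic set around
  \<open>x\<close> missing \<open>B i\<close> would give a contradiction.\<close>

lemma order_iso_bases_point:
  assumes compact: "compact_space Y"
    and B: "clopen_base I X B" and C: "clopen_base I Y C"
    and ord: "\<And>i j. i \<in> I \<Longrightarrow> j \<in> I \<Longrightarrow> B i \<subseteq> B j \<longleftrightarrow> C i \<subseteq> C j"
    and empty: "\<And>i. i \<in> I \<Longrightarrow> B i = {} \<longleftrightarrow> C i = {}"
    and x: "x \<in> topspace X"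
  shows "\<exists>y\<in>topspace Y. \<forall>i\<in>I. x \<in> B i \<longleftrightarrow> y \<in> C i"
proof -
  note clB = clopen_base_clopen[OF B] and clC = clopen_base_clopen[OF C]
  note baseB = clopen_base_nbhd[OF B] and baseC = clopen_base_nbhd[OF C]
  define J where "J = {i \<in> I. x \<in> B i}"
  have fip: "topspace Y \<inter> \<Inter> \<F> \<noteq> {}" if \<F>: "finite \<F>" "\<F> \<subseteq> C ` J" for \<F>
  proof -
    obtain F where F: "F \<subseteq> J" "finite F" "\<F> = C ` F"
      using finite_subset_image[OF \<F>] by blast
    have "openin X V" if "V \<in> B ` F" for V
      using that F(1) clB(2) by (auto simp: J_def)
    \<comment> \<open>The factor \<open>topspace X\<close> covers empty \<open>F\<close>, whose
      intersection is the whole type.\<close>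
    then have "openin X (topspace X \<inter> \<Inter> (B ` F))"
      using F(2) by (intro openin_Int_Inter) auto
    moreover have "x \<in> topspace X \<inter> \<Inter> (B ` F)"
      using F x by (auto simp: J_def)
    \<comment> \<open>Only inclusions and emptiness transfer between the bases, so a single nonempty
      basic set inside the intersection stands in for it.\<close>
    ultimately obtain k where k: "k \<in> I" "x \<in> B k" "B k \<subseteq> topspace X \<inter> \<Inter> (B ` F)"
      by (rule baseB)
    then have "C k \<subseteq> C i" if "i \<in> F" for i
      using that ord[of k i] F by (auto simp: J_def)
    moreover have "C k \<noteq> {}" "C k \<subseteq> topspace Y"
      using empty[OF k(1)] k(2) closedin_subset[OF clC(1)[OF k(1)]] by auto
    ultimately show ?thesis
      unfolding F(3) by blast
  qed
  have "compactin Y (topspace Y)"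
    using compact by (simp add: compact_space_def)
  moreover have "\<forall>D\<in>C ` J. closedin Y D"
    using clC by (auto simp: J_def)
  ultimately have "topspace Y \<inter> \<Inter> (C ` J) \<noteq> {}"
    using fip unfolding compactin_fip by blast
  then obtain y where y: "y \<in> topspace Y" "\<And>i. i \<in> I \<Longrightarrow> x \<in> B i \<Longrightarrow> y \<in> C i"
    by (auto simp: J_def)
  have "x \<in> B i" if i: "i \<in> I" "y \<in> C i" for i
  proof (rule ccontr)
    assume "x \<notin> B i"
    then have "openin X (topspace X - B i)" "x \<in> topspace X - B i"
      using x clB(1)[OF i(1)] by auto
    then obtain j where j: "j \<in> I" "x \<in> B j" "B j \<subseteq> topspace X - B i"
      by (rule baseB)
    \<comment> \<open>A basic \<open>C k\<close> around \<open>y\<close> in this intersection would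
      give a nonempty \<open>B k\<close> inside the disjoint sets \<open>B i\<close> and
      \<open>B j\<close>.\<close>
    have "openin Y (C i \<inter> C j)" "y \<in> C i \<inter> C j"
      using openin_Int[OF clC(2) clC(2)] y(2) i j(1,2) by simp_all
    then obtain k where k: "k \<in> I" "y \<in> C k" "C k \<subseteq> C i \<inter> C j"
      by (rule baseC)
    then have "B k \<subseteq> B i" "B k \<subseteq> B j" "B k \<noteq> {}"
      using ord[OF k(1) i(1)] ord[OF k(1) j(1)] empty[OF k(1)] by auto
    then show False
      using j(3) by blast
  qed
  with y show ?thesis by blast
qed

text \<open>The point correspondence is chosen in both directions. Agreement on base sets makes the
  two choices mutually inverse and makes preimages of open sets open.\<close>

lemma order_iso_bases_homeomorphic:
  assumes X: "compact_space X" "Hausdorff_space X" and Y: "compact_space Y" "Hausdorff_space Y"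
    and B: "clopen_base I X B" and C: "clopen_base I Y C"
    and ord: "\<And>i j. i \<in> I \<Longrightarrow> j \<in> I \<Longrightarrow> B i \<subseteq> B j \<longleftrightarrow> C i \<subseteq> C j"
    and empty: "\<And>i. i \<in> I \<Longrightarrow> B i = {} \<longleftrightarrow> C i = {}"
  obtains \<phi> where "homeomorphic_map X Y \<phi>"
    "\<And>i x. i \<in> I \<Longrightarrow> x \<in> topspace X \<Longrightarrow> x \<in> B i \<longleftrightarrow> \<phi> x \<in> C i"
proof -
  \<comment> \<open>Stated for arbitrary spaces and bases so as to serve both directions.\<close>
  have continuous: "continuous_map X' Y' f"
    if B': "clopen_base I X' B'" and C': "clopen_base I Y' C'"
      and f: "\<And>x. x \<in> topspace X' \<Longrightarrow> f x \<in> topspace Y' \<and> (\<forall>i\<in>I. x \<in> B' i \<longleftrightarrow> f x \<in> C' i)"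
    for X' :: "'x topology" and Y' :: "'y topology" and B' C' f
    unfolding continuous_map
  proof (intro conjI allI impI)
    show "f ` topspace X' \<subseteq> topspace Y'"
      using f by blast
  next
    fix U assume U: "openin Y' U"
    show "openin X' {x \<in> topspace X'. f x \<in> U}"
    proof (subst openin_subopen, intro ballI)
      fix x assume x: "x \<in> {x \<in> topspace X'. f x \<in> U}"
      then have "f x \<in> U"
        by simp
      with C' U obtain i where i: "i \<in> I" "f x \<in> C' i" "C' i \<subseteq> U"
        by (rule clopen_base_nbhd)
      have "openin X' (B' i)"
        using B' i(1) by (rule clopen_base_clopen)
      moreover from this have "B' i \<subseteq> {x \<in> topspace X'. f x \<in> U}"
        using openin_subset f i by blast
      ultimately show "\<exists>T. openin X' T \<and> x \<in> T \<and> T \<subseteq> {x \<in> topspace X'. f x \<in> U}"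
        using x f i by (intro exI[of _ "B' i"]) blast
    qed
  qed
  obtain \<phi> where \<phi>: "\<And>x. x \<in> topspace X \<Longrightarrow> \<phi> x \<in> topspace Y \<and> (\<forall>i\<in>I. x \<in> B i \<longleftrightarrow> \<phi> x \<in> C i)"
    using order_iso_bases_point[OF Y(1) B C ord empty] by metis
  obtain \<psi> where \<psi>: "\<And>y. y \<in> topspace Y \<Longrightarrow> \<psi> y \<in> topspace X \<and> (\<forall>i\<in>I. y \<in> C i \<longleftrightarrow> \<psi> y \<in> B i)"
    using order_iso_bases_point[OF X(1) C B ord[symmetric] empty[symmetric]] by metis
  have "\<psi> (\<phi> x) = x" if "x \<in> topspace X" for x
    using that \<phi> \<psi> by (intro clopen_base_separates[OF B X(2)]) auto
  moreover have "\<phi> (\<psi> y) = y" if "y \<in> topspace Y" for y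
    using that \<phi> \<psi> by (intro clopen_base_separates[OF C Y(2)]) auto
  moreover have "continuous_map X Y \<phi>"
    by (rule continuous[OF B C \<phi>])
  moreover have "continuous_map Y X \<psi>"
    by (rule continuous[OF C B \<psi>])
  ultimately have "homeomorphic_map X Y \<phi>"
    unfolding homeomorphic_map_maps homeomorphic_maps_def by blast
  then show ?thesis
    using \<phi> that by blast
qed

section \<open>Spatial realization of the group isomorphism\<close>

theorem theorem3p5:
  fixes X\<^sub>1 :: "'a topology" and X\<^sub>2 :: "'b topology"
    and \<Gamma>\<^sub>1 :: "('a \<Rightarrow> 'a) set" and \<Gamma>\<^sub>2 :: "('b \<Rightarrow> 'b) set"
    and \<Phi> :: "('a \<Rightarrow> 'a) \<Rightarrow> ('b \<Rightarrow> 'b)"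
  assumes "cantor_space X\<^sub>1" and "cantor_space X\<^sub>2"
    and "class_F X\<^sub>1 \<Gamma>\<^sub>1" and "class_F X\<^sub>2 \<Gamma>\<^sub>2"
    and "\<Phi> \<in> iso ((Homeo X\<^sub>1)\<lparr>carrier := \<Gamma>\<^sub>1\<rparr>) ((Homeo X\<^sub>2)\<lparr>carrier := \<Gamma>\<^sub>2\<rparr>)"
  shows "\<exists>\<phi>. homeomorphic_map X\<^sub>1 X\<^sub>2 \<phi> \<and>
    (\<forall>\<alpha>\<in>\<Gamma>\<^sub>1. \<Phi> \<alpha> = (\<lambda>y\<in>topspace X\<^sub>2. \<phi> (\<alpha> (inv_into (topspace X\<^sub>1) \<phi> y))))"
proof -
  interpret A: cantor_class_F X\<^sub>1 \<Gamma>\<^sub>1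
    by (intro cantor_class_F.intro cantor_class_F_axioms.intro assms)
  interpret B: cantor_class_F X\<^sub>2 \<Gamma>\<^sub>2
    by (intro cantor_class_F.intro cantor_class_F_axioms.intro assms)
  have \<Phi>_bij: "bij_betw \<Phi> \<Gamma>\<^sub>1 \<Gamma>\<^sub>2" and \<Phi>_hom: "\<Phi> \<in> hom A.\<G> B.\<G>"
    using assms(5) by (auto simp: iso_def)
  then have \<Phi>_in: "\<Phi> \<alpha> \<in> \<Gamma>\<^sub>2" if "\<alpha> \<in> \<Gamma>\<^sub>1" for \<alpha>
    using that bij_betwE by blast
  have \<Phi>_mult: "\<Phi> (\<alpha> \<otimes>\<^bsub>Homeo X\<^sub>1\<^esub> \<beta>) = \<Phi> \<alpha> \<otimes>\<^bsub>Homeo X\<^sub>2\<^esub> \<Phi> \<beta>" if "\<alpha> \<in> \<Gamma>\<^sub>1" "\<beta> \<in> \<Gamma>\<^sub>1" for \<alpha> \<beta>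
    using hom_mult[OF \<Phi>_hom] that by simp
  have \<Phi>_one: "\<Phi> \<one>\<^bsub>Homeo X\<^sub>1\<^esub> = \<one>\<^bsub>Homeo X\<^sub>2\<^esub>"
    using hom_one[OF \<Phi>_hom A.G.is_group B.G.is_group] by simp
  have \<Phi>_eq: "\<Phi> \<alpha> = \<Phi> \<beta> \<longleftrightarrow> \<alpha> = \<beta>" if "\<alpha> \<in> \<Gamma>\<^sub>1" "\<beta> \<in> \<Gamma>\<^sub>1" for \<alpha> \<beta>
    using \<Phi>_bij that by (auto simp: bij_betw_def inj_on_eq_iff)
  \<comment> \<open>The common index set: \<tau> labels its own support in \<open>X\<^sub>1\<close>
    and the support of \<open>\<Phi> \<tau>\<close> in \<open>X\<^sub>2\<close>. The unit is
    included and labels the empty set.\<close>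
  define I where "I = {\<tau> \<in> \<Gamma>\<^sub>1. \<tau> \<otimes>\<^bsub>Homeo X\<^sub>1\<^esub> \<tau> = \<one>\<^bsub>Homeo X\<^sub>1\<^esub>}"
  have I\<Gamma>: "\<tau> \<in> \<Gamma>\<^sub>1" if "\<tau> \<in> I" for \<tau>
    using that by (simp add: I_def)
  have \<Phi>_invol: "\<Phi> \<tau> \<otimes>\<^bsub>Homeo X\<^sub>2\<^esub> \<Phi> \<tau> = \<one>\<^bsub>Homeo X\<^sub>2\<^esub> \<longleftrightarrow> \<tau> \<in> I" if "\<tau> \<in> \<Gamma>\<^sub>1" for \<tau>
    using that \<Phi>_eq[of "\<tau> \<otimes>\<^bsub>Homeo X\<^sub>1\<^esub> \<tau>" "\<one>\<^bsub>Homeo X\<^sub>1\<^esub>"] by (simp add: I_def \<Phi>_one \<Phi>_mult)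
  have base1: "clopen_base I X\<^sub>1 (supp X\<^sub>1)"
    unfolding clopen_base_def using A.F0 A.involution_base by (simp add: I_def) metis
  have base2: "clopen_base I X\<^sub>2 (\<lambda>\<tau>. supp X\<^sub>2 (\<Phi> \<tau>))"
    unfolding clopen_base_def
  proof (intro conjI ballI allI impI)
    fix \<tau> assume "\<tau> \<in> I"
    then show "clopenin X\<^sub>2 (supp X\<^sub>2 (\<Phi> \<tau>))"
      using B.F0 \<Phi>_in[OF I\<Gamma>] \<Phi>_invol[OF I\<Gamma>] by simp
  next
    fix U x assume "openin X\<^sub>2 U \<and> x \<in> U"
    then obtain \<sigma> where \<sigma>: "\<sigma> \<in> \<Gamma>\<^sub>2" "\<sigma> \<otimes>\<^bsub>Homeo X\<^sub>2\<^esub> \<sigma> = \<one>\<^bsub>Homeo X\<^sub>2\<^esub>" "x \<in> supp X\<^sub>2 \<sigma>" "supp X\<^sub>2 \<sigma> \<subseteq> U"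
      using B.involution_base by metis
    then obtain \<tau> where "\<tau> \<in> \<Gamma>\<^sub>1" "\<sigma> = \<Phi> \<tau>"
      using \<Phi>_bij by (auto simp: bij_betw_def)
    with \<sigma> \<Phi>_invol[of \<tau>] show "\<exists>\<tau>\<in>I. x \<in> supp X\<^sub>2 (\<Phi> \<tau>) \<and> supp X\<^sub>2 (\<Phi> \<tau>) \<subseteq> U"
      by blast
  qed
  have ord: "supp X\<^sub>1 \<sigma> \<subseteq> supp X\<^sub>1 \<tau> \<longleftrightarrow> supp X\<^sub>2 (\<Phi> \<sigma>) \<subseteq> supp X\<^sub>2 (\<Phi> \<tau>)"
    if "\<sigma> \<in> I" "\<tau> \<in> I" for \<sigma> \<tau>
  proof -
    \<comment> \<open>Inclusion of supports becomes membership in a set defined by the group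
      structure, which \<Phi> carries over.\<close>
    have "supp X\<^sub>1 \<sigma> \<subseteq> supp X\<^sub>1 \<tau> \<longleftrightarrow> \<sigma> \<in> local_subgroup A.\<G> \<tau>"
      using that A.local_subgroup_eq[of \<tau>] by (simp add: I_def)
    also have "\<dots> \<longleftrightarrow> \<Phi> \<sigma> \<in> \<Phi> ` local_subgroup A.\<G> \<tau>"
    proof (rule inj_on_image_mem_iff[symmetric])
      show "inj_on \<Phi> \<Gamma>\<^sub>1"
        using \<Phi>_bij by (simp add: bij_betw_def)
      show "local_subgroup A.\<G> \<tau> \<subseteq> \<Gamma>\<^sub>1"
        by (auto simp: local_subgroup_def commutant_def)
    qed (rule I\<Gamma>[OF that(1)])
    also have "\<Phi> ` local_subgroup A.\<G> \<tau> = local_subgroup B.\<G> (\<Phi> \<tau>)"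
      using local_subgroup_iso[OF A.G.is_group B.G.is_group assms(5)] I\<Gamma>[OF that(2)] by simp
    also have "\<Phi> \<sigma> \<in> \<dots> \<longleftrightarrow> supp X\<^sub>2 (\<Phi> \<sigma>) \<subseteq> supp X\<^sub>2 (\<Phi> \<tau>)"
      using that \<Phi>_in[OF I\<Gamma>] \<Phi>_invol[OF I\<Gamma>] B.local_subgroup_eq[of "\<Phi> \<tau>"] by simp
    finally show ?thesis .
  qed
  have empty: "supp X\<^sub>1 \<tau> = {} \<longleftrightarrow> supp X\<^sub>2 (\<Phi> \<tau>) = {}" if "\<tau> \<in> I" for \<tau>
    using I\<Gamma>[OF that] \<Phi>_in[OF I\<Gamma>[OF that]] \<Phi>_eq[of \<tau> "\<one>\<^bsub>Homeo X\<^sub>1\<^esub>"]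
    by (simp add: A.supp_empty_iff B.supp_empty_iff \<Phi>_one)
  have X: "compact_space X\<^sub>1" "Hausdorff_space X\<^sub>1" "compact_space X\<^sub>2" "Hausdorff_space X\<^sub>2"
    using assms(1,2) metrizable_imp_Hausdorff_space by (auto simp: cantor_space_def)
  obtain \<phi> where \<phi>: "homeomorphic_map X\<^sub>1 X\<^sub>2 \<phi>"
      "\<And>\<tau> x. \<tau> \<in> I \<Longrightarrow> x \<in> topspace X\<^sub>1 \<Longrightarrow> x \<in> supp X\<^sub>1 \<tau> \<longleftrightarrow> \<phi> x \<in> supp X\<^sub>2 (\<Phi> \<tau>)"
    by (rule order_iso_bases_homeomorphic[OF X base1 base2], erule (1) ord, erule empty, rule that)
  have \<phi>_in: "\<phi> x \<in> topspace X\<^sub>2" if "x \<in> topspace X\<^sub>1" for x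
    using \<phi>(1) that homeomorphic_imp_surjective_map by blast
  have equivariant: "\<phi> (\<alpha> x) = \<Phi> \<alpha> (\<phi> x)" if \<alpha>: "\<alpha> \<in> \<Gamma>\<^sub>1" and x: "x \<in> topspace X\<^sub>1" for \<alpha> x
  proof (rule clopen_base_separates[OF base2 X(4)])
    show "\<phi> (\<alpha> x) \<in> topspace X\<^sub>2" "\<Phi> \<alpha> (\<phi> x) \<in> topspace X\<^sub>2"
      using \<phi>_in A.elem_in[OF \<alpha> x] B.elem_in[OF \<Phi>_in[OF \<alpha>]] x by auto
  next
    fix \<tau> assume \<tau>: "\<tau> \<in> I"
    \<comment> \<open>Conjugating \<tau> back by \<alpha> turns a condition on
      \<open>\<alpha> x\<close> into one on \<open>x\<close>, where \<phi> can be applied; \<Phi>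
      preserves the conjugation relation, so the condition is pushed forward again in
      \<open>X\<^sub>2\<close>.\<close>
    define \<sigma> where "\<sigma> = inv\<^bsub>A.\<G>\<^esub> \<alpha> \<otimes>\<^bsub>A.\<G>\<^esub> (\<tau> \<otimes>\<^bsub>A.\<G>\<^esub> \<alpha>)"
    have c: "\<alpha> \<in> carrier A.\<G>" "\<tau> \<in> carrier A.\<G>"
      using \<alpha> I\<Gamma>[OF \<tau>] by auto
    have \<sigma>: "\<sigma> \<in> carrier A.\<G>" "\<alpha> \<otimes>\<^bsub>A.\<G>\<^esub> \<sigma> = \<tau> \<otimes>\<^bsub>A.\<G>\<^esub> \<alpha>"
      unfolding \<sigma>_def using c A.G.inv_closed A.G.m_closed A.G.m_assoc[symmetric] A.G.r_inv A.G.l_one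
      by metis+
    then have \<sigma>': "\<sigma> \<in> \<Gamma>\<^sub>1" "\<alpha> \<otimes>\<^bsub>Homeo X\<^sub>1\<^esub> \<sigma> = \<tau> \<otimes>\<^bsub>Homeo X\<^sub>1\<^esub> \<alpha>"
      by auto
    \<comment> \<open>The matching property of \<phi> covers only involutions.\<close>
    have "\<sigma> \<otimes>\<^bsub>Homeo X\<^sub>1\<^esub> \<sigma> = \<one>\<^bsub>Homeo X\<^sub>1\<^esub>"
    proof (subst A.involution_iff[OF \<sigma>'(1)], intro ballI)
      fix z assume z: "z \<in> topspace X\<^sub>1"
      have *: "\<alpha> (\<sigma> w) = \<tau> (\<alpha> w)" if "w \<in> topspace X\<^sub>1" for w
        using \<sigma>' \<alpha> I\<Gamma>[OF \<tau>] that by (simp add: A.commute_iff)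
      have "\<alpha> (\<sigma> (\<sigma> z)) = \<tau> (\<tau> (\<alpha> z))"
        using * z A.elem_in[OF \<sigma>'(1)] by simp
      also have "\<dots> = \<alpha> z"
        using \<tau> A.involution_iff[OF I\<Gamma>[OF \<tau>]] A.elem_in[OF \<alpha> z] by (simp add: I_def)
      finally show "\<sigma> (\<sigma> z) = z"
        using A.elem_inj[OF \<alpha>] z A.elem_in[OF \<sigma>'(1)] by metis
    qed
    then have \<sigma>I: "\<sigma> \<in> I"
      using \<sigma>' by (simp add: I_def)
    have "\<phi> (\<alpha> x) \<in> supp X\<^sub>2 (\<Phi> \<tau>) \<longleftrightarrow> \<alpha> x \<in> supp X\<^sub>1 \<tau>"
      using \<phi>(2)[OF \<tau> A.elem_in[OF \<alpha> x]] by simp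
    also have "\<dots> \<longleftrightarrow> x \<in> supp X\<^sub>1 \<sigma>"
      by (rule A.supp_conjugate[OF \<alpha> \<sigma>'(1) I\<Gamma>[OF \<tau>] \<sigma>'(2) x])
    also have "\<dots> \<longleftrightarrow> \<phi> x \<in> supp X\<^sub>2 (\<Phi> \<sigma>)"
      by (rule \<phi>(2)[OF \<sigma>I x])
    also have "\<dots> \<longleftrightarrow> \<Phi> \<alpha> (\<phi> x) \<in> supp X\<^sub>2 (\<Phi> \<tau>)"
    proof (rule B.supp_conjugate[symmetric])
      show "\<Phi> \<alpha> \<otimes>\<^bsub>Homeo X\<^sub>2\<^esub> \<Phi> \<sigma> = \<Phi> \<tau> \<otimes>\<^bsub>Homeo X\<^sub>2\<^esub> \<Phi> \<alpha>"
        using \<Phi>_mult[OF \<alpha> \<sigma>'(1)] \<Phi>_mult[OF I\<Gamma>[OF \<tau>] \<alpha>] \<sigma>'(2) by simp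
    qed (use \<alpha> \<sigma>'(1) I\<Gamma>[OF \<tau>] \<Phi>_in \<phi>_in[OF x] in simp_all)
    finally show "\<phi> (\<alpha> x) \<in> supp X\<^sub>2 (\<Phi> \<tau>) \<longleftrightarrow> \<Phi> \<alpha> (\<phi> x) \<in> supp X\<^sub>2 (\<Phi> \<tau>)" .
  qed
  have "\<Phi> \<alpha> = (\<lambda>y\<in>topspace X\<^sub>2. \<phi> (\<alpha> (inv_into (topspace X\<^sub>1) \<phi> y)))" if \<alpha>: "\<alpha> \<in> \<Gamma>\<^sub>1" for \<alpha>
  \<comment> \<open>Both sides take the default value off the space, so comparing them on
    \<open>topspace X\<^sub>2\<close> suffices.\<close>
  proof (rule extensionalityI[OF B.elem_extensional[OF \<Phi>_in[OF \<alpha>]] restrict_extensional])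
    fix y assume y: "y \<in> topspace X\<^sub>2"
    then obtain x where x: "x \<in> topspace X\<^sub>1" "y = \<phi> x"
      using homeomorphic_imp_surjective_map[OF \<phi>(1)] by blast
    then have "inv_into (topspace X\<^sub>1) \<phi> y = x"
      using inv_into_f_f[OF homeomorphic_imp_injective_map[OF \<phi>(1)]] by simp
    then show "\<Phi> \<alpha> y = (\<lambda>y\<in>topspace X\<^sub>2. \<phi> (\<alpha> (inv_into (topspace X\<^sub>1) \<phi> y))) y"
      using y x(2) equivariant[OF \<alpha> x(1)] by simp
  qed
  with \<phi>(1) show ?thesis by blast
qed

end
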